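(* Let $\mathbf{A}$ be a commutative BCK-algebra. The spectrum $\mathrm{X}(\mathbf{A})$ is compact if and only if $\mathbf{A}$ is finitely generated as an ideal, i.e. there are finitely many elements $u_1,\dots,u_k\in A$ such that the smallest ideal of $\mathbf{A}$ containing $u_1,\dots,u_k$ is $A$ itself.
   Context: A commutative BCK-algebra is an algebra $\mathbf{A}=\langle A;\cdot,0\rangle$ of type $(2,0)$ such that for all $x,y,z\in A$: $(x\cdot y)\cdot z=(x\cdot z)\cdot y$; $x\cdot(x\cdot y)=y\cdot(y\cdot x)$; $x\cdot x=0$; $x\cdot 0=x$. Put $x\wedge y:=y\cdot(y\cdot x)$. An ideal is a subset $I\subseteq A$ with $0\in I$ such that $x\cdot y\in I$ and $y\in I$ imply $x\in I$. An ideal $P$ is prime if $P\neq A$ and $x\wedge y\in P$ implies $x\in P$ or $y\in P$. The spectrum of $\mathbf{A}$ is the set $\mathrm{X}(\mathbf{A})$ of prime ideals of $\mathbf{A}$ with the topology whose open sets are exactly the sets $\sigma(I)=\{P\in\mathrm{X}(\mathbf{A})\mid I\not\subseteq P\}$, $I$ an ideal of $\mathbf{A}$. "Compact" does not include Hausdorff. *)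

theory Defs
  imports "HOL-Analysis.Analysis"
begin

locale commutative_BCK_algebra =
  fixes A :: "'a set" and m :: "'a \<Rightarrow> 'a \<Rightarrow> 'a" and z :: 'a
  assumes closed: "\<lbrakk>x \<in> A; y \<in> A\<rbrakk> \<Longrightarrow> m x y \<in> A"
    and zero_closed: "z \<in> A"
    and exchange: "\<lbrakk>x \<in> A; y \<in> A; w \<in> A\<rbrakk> \<Longrightarrow> m (m x y) w = m (m x w) y"
    and commutative: "\<lbrakk>x \<in> A; y \<in> A\<rbrakk> \<Longrightarrow> m x (m x y) = m y (m y x)"
    and self_zero: "x \<in> A \<Longrightarrow> m x x = z"
    and right_zero: "x \<in> A \<Longrightarrow> m x z = x"

definition bck_meet :: "('a \<Rightarrow> 'a \<Rightarrow> 'a) \<Rightarrow> 'a \<Rightarrow> 'a \<Rightarrow> 'a" where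
  "bck_meet m x y = m y (m y x)"

definition bck_ideal :: "'a set \<Rightarrow> ('a \<Rightarrow> 'a \<Rightarrow> 'a) \<Rightarrow> 'a \<Rightarrow> 'a set \<Rightarrow> bool" where
  "bck_ideal A m z I \<longleftrightarrow>
     I \<subseteq> A \<and> z \<in> I \<and> (\<forall>x\<in>A. \<forall>y\<in>A. m x y \<in> I \<and> y \<in> I \<longrightarrow> x \<in> I)"

definition bck_prime_ideal :: "'a set \<Rightarrow> ('a \<Rightarrow> 'a \<Rightarrow> 'a) \<Rightarrow> 'a \<Rightarrow> 'a set \<Rightarrow> bool" where
  "bck_prime_ideal A m z P \<longleftrightarrow>
     bck_ideal A m z P \<and> P \<noteq> A \<and>
     (\<forall>x\<in>A. \<forall>y\<in>A. bck_meet m x y \<in> P \<longrightarrow> x \<in> P \<or> y \<in> P)"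

definition bck_sigma :: "'a set \<Rightarrow> ('a \<Rightarrow> 'a \<Rightarrow> 'a) \<Rightarrow> 'a \<Rightarrow> 'a set \<Rightarrow> 'a set set" where
  "bck_sigma A m z I = {P. bck_prime_ideal A m z P \<and> \<not> I \<subseteq> P}"

text \<open>The constructor \<open>topology\<close> is meaningful only for families satisfying \<open>istopology\<close>;
  this is \<open>istopology_bck_sigma\<close> below.\<close>

definition bck_spectrum :: "'a set \<Rightarrow> ('a \<Rightarrow> 'a \<Rightarrow> 'a) \<Rightarrow> 'a \<Rightarrow> 'a set topology" where
  "bck_spectrum A m z = topology (\<lambda>U. \<exists>I. bck_ideal A m z I \<and> U = bck_sigma A m z I)"

definition bck_ideal_generated :: "'a set \<Rightarrow> ('a \<Rightarrow> 'a \<Rightarrow> 'a) \<Rightarrow> 'a \<Rightarrow> 'a set \<Rightarrow> 'a set" where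
  "bck_ideal_generated A m z S = bck_ideal A m z hull S"

definition bck_finitely_generated_as_ideal ::
    "'a set \<Rightarrow> ('a \<Rightarrow> 'a \<Rightarrow> 'a) \<Rightarrow> 'a \<Rightarrow> bool" where
  "bck_finitely_generated_as_ideal A m z \<longleftrightarrow>
     (\<exists>S. finite S \<and> S \<subseteq> A \<and> bck_ideal_generated A m z S = A)"

context commutative_BCK_algebra
begin

lemma left_zero: assumes x: "x \<in> A" shows "m z x = z"
proof -
  have "m z (m z x) = z"
    using commutative[OF x zero_closed] x by (simp add: self_zero right_zero)
  then show ?thesis
    using exchange[OF zero_closed closed[OF zero_closed x] x] x
    by (simp add: self_zero closed zero_closed)
qed

lemma bck_ideal_carrier: "bck_ideal A m z A"
  by (simp add: bck_ideal_def zero_closed)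

lemma bck_ideal_Inter:
  "\<lbrakk>\<F> \<noteq> {}; \<And>I. I \<in> \<F> \<Longrightarrow> bck_ideal A m z I\<rbrakk> \<Longrightarrow> bck_ideal A m z (\<Inter>\<F>)"
  unfolding bck_ideal_def by blast

lemma bck_ideal_generated_ideal:
  assumes "S \<subseteq> A" shows "bck_ideal A m z (bck_ideal_generated A m z S)"
  unfolding bck_ideal_generated_def hull_def
  by (rule bck_ideal_Inter) (use assms bck_ideal_carrier in auto)

lemma bck_meet_in_ideal:
  assumes I: "bck_ideal A m z I" and x: "x \<in> A" and y: "y \<in> A" and "x \<in> I \<or> y \<in> I"
  shows "bck_meet m x y \<in> I"
proof -
  have *: "m a (m a b) \<in> I" if "a \<in> I" "a \<in> A" "b \<in> A" for a b
  proof -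
    have "m (m a (m a b)) a = z"
      using exchange[of a "m a b" a] that by (simp add: closed self_zero left_zero)
    then show ?thesis
      using I that closed unfolding bck_ideal_def by metis
  qed
  then show ?thesis
    using assms commutative[OF x y] unfolding bck_meet_def by metis
qed

lemma istopology_bck_sigma:
  "istopology (\<lambda>U. \<exists>I. bck_ideal A m z I \<and> U = bck_sigma A m z I)"
  unfolding istopology_def
proof (intro conjI allI impI)
  fix U V
  assume "\<exists>I. bck_ideal A m z I \<and> U = bck_sigma A m z I"
    and "\<exists>I. bck_ideal A m z I \<and> V = bck_sigma A m z I"
  then obtain I J where I: "bck_ideal A m z I" "U = bck_sigma A m z I"
    and J: "bck_ideal A m z J" "V = bck_sigma A m z J" by blast
  have ideal: "bck_ideal A m z (I \<inter> J)"
    using bck_ideal_Inter[of "{I, J}"] I J by auto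
  have "\<not> I \<inter> J \<subseteq> P" if P: "bck_prime_ideal A m z P" "\<not> I \<subseteq> P" "\<not> J \<subseteq> P" for P
  proof -
    obtain x y where xy: "x \<in> I" "x \<notin> P" "y \<in> J" "y \<notin> P" using P by blast
    then have A: "x \<in> A" "y \<in> A" using I J unfolding bck_ideal_def by auto
    have "bck_meet m x y \<in> I \<inter> J" using bck_meet_in_ideal A xy I J by blast
    moreover have "bck_meet m x y \<notin> P" using P xy A unfolding bck_prime_ideal_def by blast
    ultimately show ?thesis by blast
  qed
  then have "U \<inter> V = bck_sigma A m z (I \<inter> J)"
    unfolding I J bck_sigma_def by blast
  then show "\<exists>I. bck_ideal A m z I \<and> U \<inter> V = bck_sigma A m z I" using ideal by blast
next
  fix \<U>
  assume opens: "\<forall>U\<in>\<U>. \<exists>I. bck_ideal A m z I \<and> U = bck_sigma A m z I"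
  obtain f where "\<forall>U\<in>\<U>. bck_ideal A m z (f U) \<and> U = bck_sigma A m z (f U)"
    using bchoice[OF opens] by blast
  then have f: "bck_ideal A m z (f U)" and mem: "P \<in> U \<longleftrightarrow> P \<in> bck_sigma A m z (f U)"
    if "U \<in> \<U>" for U P
    using that by auto
  define K where "K = bck_ideal_generated A m z (\<Union>(f ` \<U>))"
  have "\<Union>(f ` \<U>) \<subseteq> A" using f unfolding bck_ideal_def by blast
  then have K: "bck_ideal A m z K" unfolding K_def by (rule bck_ideal_generated_ideal)
  have iff: "K \<subseteq> P \<longleftrightarrow> (\<forall>U\<in>\<U>. f U \<subseteq> P)" if "bck_prime_ideal A m z P" for P
  proof
    assume "K \<subseteq> P"
    then show "\<forall>U\<in>\<U>. f U \<subseteq> P"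
      using hull_subset[of "\<Union>(f ` \<U>)" "bck_ideal A m z"]
      unfolding K_def bck_ideal_generated_def by blast
  next
    assume "\<forall>U\<in>\<U>. f U \<subseteq> P"
    then show "K \<subseteq> P" unfolding K_def bck_ideal_generated_def
      using that by (intro hull_minimal) (auto simp: bck_prime_ideal_def)
  qed
  have "P \<in> \<Union>\<U> \<longleftrightarrow> P \<in> bck_sigma A m z K" for P
  proof -
    have "P \<in> \<Union>\<U> \<longleftrightarrow> (\<exists>U\<in>\<U>. P \<in> bck_sigma A m z (f U))"
      by (simp add: mem)
    also have "\<dots> \<longleftrightarrow> P \<in> bck_sigma A m z K"
      using iff[of P] by (auto simp only: bck_sigma_def mem_Collect_eq)
    finally show ?thesis .
  qed
  then have "\<Union>\<U> = bck_sigma A m z K" by (rule set_eqI)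
  with K show "\<exists>I. bck_ideal A m z I \<and> \<Union>\<U> = bck_sigma A m z I" by (intro exI conjI)
qed

lemma openin_bck_spectrum:
  "openin (bck_spectrum A m z) U \<longleftrightarrow> (\<exists>I. bck_ideal A m z I \<and> U = bck_sigma A m z I)"
  unfolding bck_spectrum_def topology_inverse'[OF istopology_bck_sigma] ..

lemma topspace_bck_spectrum: "topspace (bck_spectrum A m z) = {P. bck_prime_ideal A m z P}"
proof
  show "topspace (bck_spectrum A m z) \<subseteq> {P. bck_prime_ideal A m z P}"
    unfolding topspace_def openin_bck_spectrum by (auto simp: bck_sigma_def)
  have "{P. bck_prime_ideal A m z P} = bck_sigma A m z A"
    unfolding bck_sigma_def bck_prime_ideal_def bck_ideal_def by auto
  then have "openin (bck_spectrum A m z) {P. bck_prime_ideal A m z P}"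
    unfolding openin_bck_spectrum using bck_ideal_carrier by (intro exI conjI)
  then show "{P. bck_prime_ideal A m z P} \<subseteq> topspace (bck_spectrum A m z)"
    by (rule openin_subset)
qed

end

end

theory Submission
  imports Defs
begin

text \<open>
  Compactness of the spectrum is translated into a statement about ideals by the fact that every
  proper ideal lies in a prime ideal (\<open>ideal_eq_carrier_if_in_no_prime\<close>): the open sets
  \<open>\<sigma>(I\<^sub>j)\<close> cover the spectrum exactly if the ideals \<open>I\<^sub>j\<close> together generate the whole algebra.
  A finite subcover is thus a finite subfamily of the \<open>I\<^sub>j\<close> that still generates the algebra.
  If the spectrum is compact, the cover by the sets \<open>\<sigma>(\<langle>a\<rangle>)\<close>, one for each element \<open>a\<close>, has a finite
  subcover, and the elements in it generate. Conversely, if the algebra is generated by finitely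
  many elements, each of them lies in the ideal generated by finitely many elements of
  \<open>\<Union>\<^sub>j I\<^sub>j\<close>, since ideal generation is finitary (\<open>finite_subset_generated\<close>), so finitely many of
  the \<open>I\<^sub>j\<close> suffice.

  The prime ideal theorem comes from Zorn's lemma: an ideal \<open>P\<close> that is maximal among those avoiding
  an element \<open>x\<close> is prime. The usual proof computes with the elements of the ideal generated by
  \<open>P\<close> and one more element. A shorter way is to use the ideal quotients
  \<open>P : b = {y. y \<and> b \<in> P}\<close>, which are ideals because \<open>\<and>\<close> satisfies
  \<open>(x \<and> b) \<cdot> (y \<and> b) \<le> (x \<cdot> y) \<and> b\<close>. If \<open>a \<and> b \<in> P\<close> with \<open>a, b \<notin> P\<close>, then \<open>P : b\<close>
  properly extends \<open>P\<close> by \<open>a\<close>, so it contains \<open>x\<close> by maximality; by symmetry of \<open>\<and>\<close> this says that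
  \<open>P : x\<close> contains \<open>b\<close>, so \<open>P : x\<close> also contains \<open>x\<close>, that is, \<open>x = x \<and> x \<in> P\<close>.
\<close>

context commutative_BCK_algebra
begin

section \<open>The natural order and its meet\<close>

text \<open>The equation \<open>x \<cdot> y = 0\<close> is read as \<open>x \<le> y\<close>, the natural order of the algebra.\<close>

lemma product_le_left: "\<lbrakk>x \<in> A; y \<in> A\<rbrakk> \<Longrightarrow> m (m x y) x = z"
  using exchange[of x y x] by (simp add: self_zero left_zero)

text \<open>All monotonicity properties of the product come from this identity, in which both sides are
  \<open>(x \<and> w) \<cdot> y\<close>, up to exchange.\<close>

lemma product_swap:
  assumes "x \<in> A" "y \<in> A" "w \<in> A"
  shows "m (m x y) (m x w) = m (m w y) (m w x)"
  using assms exchange[of x y "m x w"] exchange[of w y "m w x"] commutative[of x w]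
  by (simp add: closed)

lemma le_trans_bck:
  assumes "x \<in> A" "y \<in> A" "w \<in> A" "m x y = z" "m y w = z"
  shows "m x w = z"
  using product_swap[of x w y] assms by (simp add: closed left_zero right_zero)

lemma product_antimono_right:
  assumes "x \<in> A" "v \<in> A" "w \<in> A" "m v w = z"
  shows "m (m x w) (m x v) = z"
  using product_swap[of x w v] assms by (simp add: closed left_zero)

lemma product_mono_left:
  assumes "x \<in> A" "y \<in> A" "w \<in> A" "m x y = z"
  shows "m (m x w) (m y w) = z"
proof -
  have "m x w = m (m y w) (m y x)"
    using product_swap[of x w y] assms by (simp add: closed right_zero)
  then show ?thesis
    using product_le_left[of "m y w" "m y x"] assms by (simp add: closed)
qed

lemma meet_closed: "\<lbrakk>x \<in> A; y \<in> A\<rbrakk> \<Longrightarrow> bck_meet m x y \<in> A"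
  by (simp add: bck_meet_def closed)

lemma meet_commute: "\<lbrakk>x \<in> A; y \<in> A\<rbrakk> \<Longrightarrow> bck_meet m x y = bck_meet m y x"
  unfolding bck_meet_def by (rule commutative)

lemma meet_idem: "x \<in> A \<Longrightarrow> bck_meet m x x = x"
  by (simp add: bck_meet_def self_zero right_zero)

lemma meet_le_right: "\<lbrakk>x \<in> A; y \<in> A\<rbrakk> \<Longrightarrow> m (bck_meet m x y) y = z"
  by (simp add: bck_meet_def product_le_left closed)

lemma meet_le_left: "\<lbrakk>x \<in> A; y \<in> A\<rbrakk> \<Longrightarrow> m (bck_meet m x y) x = z"
  using meet_le_right[of y x] by (simp add: meet_commute)

lemma le_meet:
  assumes "w \<in> A" "x \<in> A" "y \<in> A" "m w x = z" "m w y = z"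
  shows "m w (bck_meet m x y) = z"
proof -
  \<comment> \<open>Double subtraction from \<open>y\<close> fixes \<open>w\<close>, as \<open>w \<le> y\<close>, and it is monotone.\<close>
  have "m y (m y w) = w"
    using commutative[of y w] assms by (simp add: right_zero)
  moreover have "m (m y (m y w)) (m y (m y x)) = z"
    using assms by (intro product_antimono_right closed)
  ultimately show ?thesis by (simp add: bck_meet_def)
qed

lemma product_meet:
  assumes "x \<in> A" "y \<in> A"
  shows "m x (bck_meet m x y) = m x y"
proof -
  have "m x (bck_meet m x y) = m x (m x (m x y))"
    using commutative[of x y] assms by (simp add: bck_meet_def)
  also have "\<dots> = m (m x y) (m (m x y) x)"
    using assms by (intro commutative closed)
  also have "\<dots> = m x y"
    using assms by (simp add: product_le_left right_zero closed)
  finally show ?thesis .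
qed

text \<open>Meeting with \<open>b\<close> can only shrink differences. Indeed \<open>y \<and> b\<close> lies above \<open>(x \<and> b) \<and> y\<close>, and
  subtracting the latter from \<open>x \<and> b\<close> is the same as subtracting \<open>y\<close>.\<close>

lemma product_of_meets_le:
  assumes A: "x \<in> A" "y \<in> A" "b \<in> A"
  shows "m (m (bck_meet m x b) (bck_meet m y b)) (bck_meet m (m x y) b) = z"
proof -
  define p where "p = bck_meet m x b"
  define q where "q = bck_meet m y b"
  have pq: "p \<in> A" "q \<in> A" "bck_meet m p y \<in> A"
    using A by (simp_all add: p_def q_def meet_closed)
  have p_le: "m p x = z" "m p b = z"
    using A by (simp_all add: p_def meet_le_left meet_le_right)
  have "m (bck_meet m p y) b = z"
    using le_trans_bck[of "bck_meet m p y" p b] meet_le_left[of p y] pq p_le A by simp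
  then have "m (bck_meet m p y) q = z"
    unfolding q_def using pq A by (intro le_meet meet_le_right)
  then have "m (m p q) (m p y) = z"
    using product_antimono_right[of p "bck_meet m p y" q] pq A by (simp add: product_meet)
  moreover have "m (m p y) (m x y) = z"
    using product_mono_left pq A p_le by blast
  ultimately have "m (m p q) (m x y) = z"
    using le_trans_bck[of "m p q" "m p y" "m x y"] pq A by (simp add: closed)
  moreover have "m (m p q) b = z"
    using le_trans_bck[of "m p q" p b] pq A p_le by (simp add: closed product_le_left)
  ultimately show ?thesis
    unfolding p_def[symmetric] q_def[symmetric] using pq A by (intro le_meet closed)
qed

section \<open>Ideals and prime ideals\<close>

lemma ideal_downward_closed:
  "\<lbrakk>bck_ideal A m z I; x \<in> A; y \<in> I; m x y = z\<rbrakk> \<Longrightarrow> x \<in> I"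
  unfolding bck_ideal_def by (metis subsetD)

lemma ideal_quotient:
  assumes I: "bck_ideal A m z I" and b: "b \<in> A"
  shows "bck_ideal A m z {x \<in> A. bck_meet m x b \<in> I}"
  unfolding bck_ideal_def
proof (intro conjI ballI impI)
  show "z \<in> {x \<in> A. bck_meet m x b \<in> I}"
    using bck_meet_in_ideal[OF I zero_closed b] I by (simp add: zero_closed bck_ideal_def)
next
  fix x y
  assume xy: "x \<in> A" "y \<in> A"
    and "m x y \<in> {x \<in> A. bck_meet m x b \<in> I} \<and> y \<in> {x \<in> A. bck_meet m x b \<in> I}"
  then have mem: "bck_meet m (m x y) b \<in> I" "bck_meet m y b \<in> I" by auto
  have "m (bck_meet m x b) (bck_meet m y b) \<in> I"
    using ideal_downward_closed[OF I _ mem(1) product_of_meets_le] xy b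
    by (simp add: meet_closed closed)
  then show "x \<in> {x \<in> A. bck_meet m x b \<in> I}"
    using I mem(2) xy b meet_closed unfolding bck_ideal_def by blast
qed blast

text \<open>Used twice: for chains of ideals in Zorn's lemma, and for the ideals generated by the finite
  subsets of a set.\<close>

lemma ideal_directed_Union:
  assumes "\<F> \<noteq> {}" and ideal: "\<And>I. I \<in> \<F> \<Longrightarrow> bck_ideal A m z I"
    and directed: "\<And>I J. \<lbrakk>I \<in> \<F>; J \<in> \<F>\<rbrakk> \<Longrightarrow> \<exists>K\<in>\<F>. I \<union> J \<subseteq> K"
  shows "bck_ideal A m z (\<Union>\<F>)"
  unfolding bck_ideal_def
proof (intro conjI ballI impI)
  show "\<Union>\<F> \<subseteq> A" "z \<in> \<Union>\<F>"
    using assms(1) ideal unfolding bck_ideal_def by blast+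
next
  fix x y
  assume "x \<in> A" "y \<in> A" and "m x y \<in> \<Union>\<F> \<and> y \<in> \<Union>\<F>"
  then obtain K where "K \<in> \<F>" "m x y \<in> K" "y \<in> K"
    using directed by (meson UnCI UnionE subsetD)
  then show "x \<in> \<Union>\<F>"
    using ideal \<open>x \<in> A\<close> \<open>y \<in> A\<close> unfolding bck_ideal_def by blast
qed

text \<open>If \<open>c \<notin> P\<close> and \<open>c \<and> d \<in> P\<close>, then \<open>c\<close> witnesses that \<open>P : d\<close> properly extends \<open>P\<close>, so
  \<open>x \<and> d \<in> P\<close> by maximality. For \<open>a, b \<notin> P\<close> with \<open>a \<and> b \<in> P\<close> this is applied first to the pair
  \<open>a, b\<close> and then to the pair \<open>b, x\<close>, and yields \<open>x \<and> x \<in> P\<close>.\<close>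

lemma prime_if_maximal_avoiding:
  assumes P: "bck_ideal A m z P" and x: "x \<in> A" "x \<notin> P"
    and maximal: "\<And>Q. \<lbrakk>bck_ideal A m z Q; P \<subset> Q\<rbrakk> \<Longrightarrow> x \<in> Q"
  shows "bck_prime_ideal A m z P"
proof -
  have step: "bck_meet m x d \<in> P" if "c \<in> A" "d \<in> A" "c \<notin> P" "bck_meet m c d \<in> P" for c d
  proof -
    have "P \<subseteq> A" using P by (simp add: bck_ideal_def)
    then have "P \<subset> {y \<in> A. bck_meet m y d \<in> P}"
      using bck_meet_in_ideal[OF P _ that(2)] that by blast
    then have "x \<in> {y \<in> A. bck_meet m y d \<in> P}"
      by (intro maximal ideal_quotient P that)
    then show ?thesis by simp
  qed
  have "a \<in> P \<or> b \<in> P" if ab: "a \<in> A" "b \<in> A" "bck_meet m a b \<in> P" for a b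
  proof (rule ccontr)
    assume n: "\<not> (a \<in> P \<or> b \<in> P)"
    then have "bck_meet m b x \<in> P"
      using step[of a b] ab x by (simp add: meet_commute)
    then show False
      using step[of b x] n ab x by (simp add: meet_idem)
  qed
  then show ?thesis
    using P x unfolding bck_prime_ideal_def by blast
qed

lemma prime_ideal_separation:
  assumes I: "bck_ideal A m z I" and x: "x \<in> A" "x \<notin> I"
  obtains P where "bck_prime_ideal A m z P" "I \<subseteq> P" "x \<notin> P"
proof -
  let ?S = "{J. bck_ideal A m z J \<and> I \<subseteq> J \<and> x \<notin> J}"
  have "\<exists>P\<in>?S. \<forall>J\<in>?S. P \<subseteq> J \<longrightarrow> J = P"
  proof (rule subset_Zorn_nonempty)
    show "?S \<noteq> {}" using I x by blast
  next
    fix \<C> assume C: "\<C> \<noteq> {}" "subset.chain ?S \<C>"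
    have "\<exists>K\<in>\<C>. J \<union> L \<subseteq> K" if "J \<in> \<C>" "L \<in> \<C>" for J L
      using C that unfolding subset_chain_def by (metis le_sup_iff order_refl)
    then have "bck_ideal A m z (\<Union>\<C>)"
      using C by (intro ideal_directed_Union) (auto simp: subset_chain_def)
    then show "\<Union>\<C> \<in> ?S"
      using C unfolding subset_chain_def by blast
  qed
  then obtain P where P: "bck_ideal A m z P" "I \<subseteq> P" "x \<notin> P"
    and max: "\<forall>J\<in>?S. P \<subseteq> J \<longrightarrow> J = P" by blast
  have "bck_prime_ideal A m z P"
    using P(1) x(1) P(3)
  proof (rule prime_if_maximal_avoiding)
    show "x \<in> Q" if "bck_ideal A m z Q" "P \<subset> Q" for Q
      using max that P(2) by blast
  qed
  then show thesis using that P by blast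
qed

lemma ideal_eq_carrier_if_in_no_prime:
  assumes I: "bck_ideal A m z I" and "\<And>P. bck_prime_ideal A m z P \<Longrightarrow> \<not> I \<subseteq> P"
  shows "I = A"
proof (rule ccontr)
  assume "I \<noteq> A"
  then obtain x where "x \<in> A" "x \<notin> I" using I unfolding bck_ideal_def by blast
  then show False using prime_ideal_separation[OF I] assms(2) by blast
qed

section \<open>Generated ideals\<close>

lemma subset_generated: "S \<subseteq> bck_ideal_generated A m z S"
  unfolding bck_ideal_generated_def by (rule hull_subset)

lemma generated_minimal:
  "\<lbrakk>S \<subseteq> I; bck_ideal A m z I\<rbrakk> \<Longrightarrow> bck_ideal_generated A m z S \<subseteq> I"
  unfolding bck_ideal_generated_def by (rule hull_minimal)

lemma generated_mono:
  "S \<subseteq> T \<Longrightarrow> bck_ideal_generated A m z S \<subseteq> bck_ideal_generated A m z T"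
  unfolding bck_ideal_generated_def by (rule hull_mono)

text \<open>The ideals generated by the finite subsets of \<open>X\<close> form a directed family, so their union is
  already an ideal and exhausts the ideal generated by \<open>X\<close>.\<close>

lemma generated_finitary:
  assumes X: "X \<subseteq> A" and x: "x \<in> bck_ideal_generated A m z X"
  obtains F where "finite F" "F \<subseteq> X" "x \<in> bck_ideal_generated A m z F"
proof -
  let ?G = "bck_ideal_generated A m z ` {F. finite F \<and> F \<subseteq> X}"
  have "\<exists>K\<in>?G. I \<union> J \<subseteq> K" if IJ: "I \<in> ?G" "J \<in> ?G" for I J
  proof -
    obtain F H where "finite F" "F \<subseteq> X" "I = bck_ideal_generated A m z F"
      and "finite H" "H \<subseteq> X" "J = bck_ideal_generated A m z H" using IJ by blast
    then show ?thesis
      by (intro bexI[of _ "bck_ideal_generated A m z (F \<union> H)"])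
        (auto simp: generated_mono subsetD[OF generated_mono])
  qed
  moreover have "bck_ideal A m z I" if "I \<in> ?G" for I
    using that X bck_ideal_generated_ideal by blast
  ultimately have "bck_ideal A m z (\<Union>?G)"
    by (intro ideal_directed_Union) auto
  moreover have "X \<subseteq> \<Union>?G"
  proof
    fix y assume "y \<in> X"
    then show "y \<in> \<Union>?G"
      using subset_generated[of "{y}"] by (intro UnionI[of "bck_ideal_generated A m z {y}"]) auto
  qed
  ultimately have "bck_ideal_generated A m z X \<subseteq> \<Union>?G"
    by (intro generated_minimal)
  then show thesis using that x by blast
qed

lemma finite_subset_generated:
  assumes X: "X \<subseteq> A" and S: "finite S" "S \<subseteq> bck_ideal_generated A m z X"
  obtains F where "finite F" "F \<subseteq> X" "S \<subseteq> bck_ideal_generated A m z F"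
proof -
  have "\<forall>s\<in>S. \<exists>F. finite F \<and> F \<subseteq> X \<and> s \<in> bck_ideal_generated A m z F"
    using generated_finitary[OF X] S(2) by (metis subsetD)
  then obtain f where f: "\<forall>s\<in>S. finite (f s) \<and> f s \<subseteq> X \<and> s \<in> bck_ideal_generated A m z (f s)"
    by (auto dest: bchoice)
  show thesis
  proof
    show "finite (\<Union>(f ` S))" "\<Union>(f ` S) \<subseteq> X" using S(1) f by auto
    show "S \<subseteq> bck_ideal_generated A m z (\<Union>(f ` S))"
      using f generated_mono[OF UN_upper, of _ S f] by blast
  qed
qed

lemma generated_subset_prime_iff:
  "bck_prime_ideal A m z P \<Longrightarrow> bck_ideal_generated A m z S \<subseteq> P \<longleftrightarrow> S \<subseteq> P"
  using generated_minimal[of S P] subset_generated[of S] unfolding bck_prime_ideal_def by blast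

section \<open>Compactness of the spectrum\<close>

lemma compact_imp_finitely_generated:
  assumes compact: "compact_space (bck_spectrum A m z)"
  shows "bck_finitely_generated_as_ideal A m z"
proof -
  define D where "D a = bck_sigma A m z (bck_ideal_generated A m z {a})" for a
  have D_iff: "P \<in> D a \<longleftrightarrow> bck_prime_ideal A m z P \<and> a \<notin> P" for P a
    unfolding D_def bck_sigma_def using generated_subset_prime_iff[of P "{a}"] by auto
  have "openin (bck_spectrum A m z) U" if "U \<in> D ` A" for U
    using that bck_ideal_generated_ideal unfolding openin_bck_spectrum D_def by blast
  moreover have "topspace (bck_spectrum A m z) \<subseteq> \<Union>(D ` A)"
    unfolding topspace_bck_spectrum using D_iff
    by (auto simp: bck_prime_ideal_def bck_ideal_def)
  ultimately obtain \<V> where "finite \<V>" "\<V> \<subseteq> D ` A" "topspace (bck_spectrum A m z) \<subseteq> \<Union>\<V>"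
    using compact unfolding compact_space_alt by meson
  then obtain S where S: "finite S" "S \<subseteq> A" "topspace (bck_spectrum A m z) \<subseteq> \<Union>(D ` S)"
    by (metis finite_subset_image)
  have "bck_ideal_generated A m z S = A"
  proof (rule ideal_eq_carrier_if_in_no_prime)
    show "bck_ideal A m z (bck_ideal_generated A m z S)"
      using S(2) by (rule bck_ideal_generated_ideal)
    show "\<not> bck_ideal_generated A m z S \<subseteq> P" if "bck_prime_ideal A m z P" for P
      using S(3) that D_iff unfolding topspace_bck_spectrum generated_subset_prime_iff[OF that]
      by blast
  qed
  then show ?thesis
    unfolding bck_finitely_generated_as_ideal_def using S by blast
qed

lemma finitely_generated_imp_compact:
  assumes "bck_finitely_generated_as_ideal A m z"
  shows "compact_space (bck_spectrum A m z)"
  unfolding compact_space_alt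
proof (intro allI impI, elim conjE)
  obtain S where S: "finite S" "S \<subseteq> A" "bck_ideal_generated A m z S = A"
    using assms unfolding bck_finitely_generated_as_ideal_def by blast
  fix \<U>
  assume opens: "\<forall>U\<in>\<U>. openin (bck_spectrum A m z) U"
    and cover: "topspace (bck_spectrum A m z) \<subseteq> \<Union>\<U>"
  obtain f where f: "\<forall>U\<in>\<U>. bck_ideal A m z (f U) \<and> U = bck_sigma A m z (f U)"
    using bchoice[OF opens[unfolded openin_bck_spectrum]] by blast
  have mem: "P \<in> U \<longleftrightarrow> \<not> f U \<subseteq> P" if "U \<in> \<U>" "bck_prime_ideal A m z P" for U P
    using f that unfolding bck_sigma_def by blast
  let ?X = "\<Union>(f ` \<U>)"
  have X: "?X \<subseteq> A" using f unfolding bck_ideal_def by blast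
  have "bck_ideal_generated A m z ?X = A"
  proof (rule ideal_eq_carrier_if_in_no_prime)
    show "bck_ideal A m z (bck_ideal_generated A m z ?X)"
      using X by (rule bck_ideal_generated_ideal)
    show "\<not> bck_ideal_generated A m z ?X \<subseteq> P" if P: "bck_prime_ideal A m z P" for P
    proof -
      obtain U where "U \<in> \<U>" "P \<in> U" using cover P unfolding topspace_bck_spectrum by blast
      then show ?thesis unfolding generated_subset_prime_iff[OF P] using mem P by blast
    qed
  qed
  then obtain F where F: "finite F" "F \<subseteq> ?X" "S \<subseteq> bck_ideal_generated A m z F"
    using finite_subset_generated[OF X S(1)] S(2) by metis
  then obtain \<V> where V: "finite \<V>" "\<V> \<subseteq> \<U>" "F \<subseteq> \<Union>(f ` \<V>)"
    by (metis finite_subset_Union finite_subset_image)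
  have "bck_ideal A m z (bck_ideal_generated A m z F)"
    using F(2) X by (intro bck_ideal_generated_ideal) blast
  then have AF: "A \<subseteq> bck_ideal_generated A m z F"
    using generated_minimal[OF F(3)] S(3) by simp
  have "topspace (bck_spectrum A m z) \<subseteq> \<Union>\<V>"
  proof
    fix P assume "P \<in> topspace (bck_spectrum A m z)"
    then have P: "bck_prime_ideal A m z P" by (simp add: topspace_bck_spectrum)
    then have "\<not> A \<subseteq> P" unfolding bck_prime_ideal_def bck_ideal_def by blast
    then have "\<not> F \<subseteq> P" using AF generated_subset_prime_iff[OF P, of F] by blast
    then obtain U where "U \<in> \<V>" "\<not> f U \<subseteq> P" using V(3) by blast
    then show "P \<in> \<Union>\<V>" using mem[OF _ P] V(2) by blast
  qed
  then show "\<exists>\<V>. finite \<V> \<and> \<V> \<subseteq> \<U> \<and> topspace (bck_spectrum A m z) \<subseteq> \<Union>\<V>"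
    using V by blast
qed

end

theorem theorem4p7:
  fixes A :: "'a set" and m :: "'a \<Rightarrow> 'a \<Rightarrow> 'a" and z :: 'a
  assumes "commutative_BCK_algebra A m z"
  shows "compact_space (bck_spectrum A m z) \<longleftrightarrow> bck_finitely_generated_as_ideal A m z"
proof -
  interpret commutative_BCK_algebra A m z by (rule assms)
  show ?thesis
    using compact_imp_finitely_generated finitely_generated_imp_compact by blast
qed

end
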